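(* For nonempty compact metric spaces $X,Y$, $$d_{\mathrm I}^{\chi}(X,Y)\le d_{\mathrm I}^{\mathrm{Bor}}(X,Y)\le 2\,d_{\mathrm{GH}}(X,Y).$$
   Context: For a nonempty metric space $X$ and $s>0$, the closed Borsuk graph $\mathrm{Bor}_{\ge s}(X)$ is the simple graph with vertex set $X$ in which distinct points are adjacent exactly when their distance is at least $s$. $d_{\mathrm I}^{\mathrm{Bor}}(X,Y)$ is the infimum of the $\delta\ge0$ such that, for every $u>\delta$, there exist graph homomorphisms $\mathrm{Bor}_{\ge u}(X)\to\mathrm{Bor}_{\ge u-\delta}(Y)$ and $\mathrm{Bor}_{\ge u}(Y)\to\mathrm{Bor}_{\ge u-\delta}(X)$. The chromatic profile is $\chi_X(s):=\chi(\mathrm{Bor}_{\ge s}(X))$, the chromatic number of the graph (it is finite for every $s>0$ if $X$ is totally bounded). $d_{\mathrm I}^{\chi}(X,Y)$ is the infimum of the $\delta\ge0$ such that, for every $u>\delta$, $\chi_X(u)\le\chi_Y(u-\delta)$ and $\chi_Y(u)\le\chi_X(u-\delta)$. $d_{\mathrm{GH}}$ is the Gromov--Hausdorff distance; equivalently $d_{\mathrm{GH}}(X,Y)=\tfrac12\inf_{\mathcal R}\mathrm{dis}(\mathcal R)$ over all relations $\mathcal R\subseteq X\times Y$ projecting onto both factors, where $\mathrm{dis}(\mathcal R)=\sup\{|d_X(x,x')-d_Y(y,y')|:(x,y),(x',y')\in\mathcal R\}$. *)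

theory Defs
  imports "HOL-Analysis.Analysis"
begin

record 'a sgraph =
  verts :: "'a set"
  adj :: "('a \<times> 'a) set"

definition simple_graph :: "'a sgraph \<Rightarrow> bool" where
  "simple_graph G \<longleftrightarrow> adj G \<subseteq> verts G \<times> verts G \<and> sym (adj G) \<and> irrefl (adj G)"

definition graph_hom :: "'a sgraph \<Rightarrow> 'b sgraph \<Rightarrow> ('a \<Rightarrow> 'b) \<Rightarrow> bool" where
  "graph_hom G H f \<longleftrightarrow>
     f ` verts G \<subseteq> verts H \<and> (\<forall>x y. (x, y) \<in> adj G \<longrightarrow> (f x, f y) \<in> adj H)"

definition colorable :: "'a sgraph \<Rightarrow> nat \<Rightarrow> bool" where
  "colorable G n \<longleftrightarrow>
     (\<exists>c :: 'a \<Rightarrow> nat. c ` verts G \<subseteq> {..<n} \<and> (\<forall>x y. (x, y) \<in> adj G \<longrightarrow> c x \<noteq> c y))"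

text \<open>
  The value is \<open>\<infinity>\<close> if there is no colouring with finitely many colours; infinite chromatic
  numbers are not distinguished from each other.
\<close>
definition chromatic_number :: "'a sgraph \<Rightarrow> enat" where
  "chromatic_number G = (INF n \<in> {n. colorable G n}. enat n)"

definition Bor :: "real \<Rightarrow> 'a metric \<Rightarrow> 'a sgraph" where
  "Bor s X = \<lparr>verts = mspace X,
     adj = {(x, y). x \<in> mspace X \<and> y \<in> mspace X \<and> x \<noteq> y \<and> s \<le> mdist X x y}\<rparr>"

lemma simple_graph_Bor: "simple_graph (Bor s X)"
  by (auto simp: simple_graph_def Bor_def sym_def irrefl_def mdist_commute)

definition chromatic_profile :: "'a metric \<Rightarrow> real \<Rightarrow> enat" where
  "chromatic_profile X s = chromatic_number (Bor s X)"

text \<open>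
  The three distances are \<^typ>\<open>ennreal\<close>-valued, so that an infimum over the empty set and the
  distortion of an unbounded relation are \<open>\<infinity>\<close>.
\<close>

definition dI_Bor :: "'a metric \<Rightarrow> 'b metric \<Rightarrow> ennreal" where
  "dI_Bor X Y =
     (INF \<delta> \<in> {\<delta>::real. 0 \<le> \<delta> \<and>
        (\<forall>u>\<delta>. (\<exists>f. graph_hom (Bor u X) (Bor (u - \<delta>) Y) f) \<and>
               (\<exists>g. graph_hom (Bor u Y) (Bor (u - \<delta>) X) g))}. ennreal \<delta>)"

definition dI_chi :: "'a metric \<Rightarrow> 'b metric \<Rightarrow> ennreal" where
  "dI_chi X Y =
     (INF \<delta> \<in> {\<delta>::real. 0 \<le> \<delta> \<and>
        (\<forall>u>\<delta>. chromatic_profile X u \<le> chromatic_profile Y (u - \<delta>) \<and>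
               chromatic_profile Y u \<le> chromatic_profile X (u - \<delta>))}. ennreal \<delta>)"

definition correspondence :: "'a metric \<Rightarrow> 'b metric \<Rightarrow> ('a \<times> 'b) set \<Rightarrow> bool" where
  "correspondence X Y R \<longleftrightarrow>
     R \<subseteq> mspace X \<times> mspace Y \<and> fst ` R = mspace X \<and> snd ` R = mspace Y"

definition distortion :: "'a metric \<Rightarrow> 'b metric \<Rightarrow> ('a \<times> 'b) set \<Rightarrow> ennreal" where
  "distortion X Y R =
     (SUP ((x, y), (x', y')) \<in> R \<times> R. ennreal \<bar>mdist X x x' - mdist Y y y'\<bar>)"

definition GH_dist :: "'a metric \<Rightarrow> 'b metric \<Rightarrow> ennreal" where
  "GH_dist X Y = 1 / 2 * (INF R \<in> {R. correspondence X Y R}. distortion X Y R)"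

end

theory Submission
  imports Defs
begin

text \<open>
  Both inequalities compare infima of admissible shifts \<open>\<delta>\<close>, so each follows by turning one kind
  of witness into another. A graph homomorphism pulls colourings back, hence homomorphisms in both
  directions give both inequalities between the chromatic profiles, with the same \<open>\<delta>\<close>
  (\<open>chromatic_number_mono_graph_hom\<close>). And if a correspondence has finite distortion \<open>\<delta>\<close>, then any
  function selecting for each point of \<open>X\<close> a corresponding point of \<open>Y\<close> changes distances by at
  most \<open>\<delta>\<close>; for \<open>u > \<delta>\<close> it therefore sends points at distance at least \<open>u\<close> to points at distance
  at least \<open>u - \<delta> > 0\<close>, which are in particular distinct
  (\<open>graph_hom_Bor_of_correspondence\<close>). The converse correspondence provides the homomorphisms from
  \<open>Y\<close> to \<open>X\<close>. So every correspondence bounds \<open>dI_Bor X Y\<close> by its distortion, and the infimum of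
  these distortions is twice the Gromov--Hausdorff distance.
\<close>

lemma colorable_pullback:
  assumes "graph_hom G H f" and "colorable H n"
  shows "colorable G n"
proof -
  obtain c where "c ` verts H \<subseteq> {..<n}" "\<forall>x y. (x, y) \<in> adj H \<longrightarrow> c x \<noteq> (c y :: nat)"
    using assms(2) unfolding colorable_def by blast
  with assms(1) show ?thesis
    unfolding colorable_def graph_hom_def
    by (intro exI[of _ "c \<circ> f"]) (simp add: image_subset_iff)
qed

lemma chromatic_number_mono_graph_hom:
  assumes "graph_hom G H f"
  shows "chromatic_number G \<le> chromatic_number H"
  unfolding chromatic_number_def
  by (intro Inf_superset_mono image_mono Collect_mono impI) (rule colorable_pullback[OF assms])

lemma dI_chi_le_dI_Bor: "dI_chi X Y \<le> dI_Bor X Y"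
  unfolding dI_chi_def dI_Bor_def chromatic_profile_def
proof (rule Inf_superset_mono, rule image_mono, rule Collect_mono,
    intro impI, elim conjE, intro conjI allI impI, assumption)
  fix \<delta> u :: real
  assume homs: "\<forall>u>\<delta>. (\<exists>f. graph_hom (Bor u X) (Bor (u - \<delta>) Y) f) \<and>
      (\<exists>g. graph_hom (Bor u Y) (Bor (u - \<delta>) X) g)" and u: "\<delta> < u"
  show "chromatic_number (Bor u X) \<le> chromatic_number (Bor (u - \<delta>) Y)"
    using homs[rule_format, OF u] chromatic_number_mono_graph_hom by metis
  show "chromatic_number (Bor u Y) \<le> chromatic_number (Bor (u - \<delta>) X)"
    using homs[rule_format, OF u] chromatic_number_mono_graph_hom by metis
qed

lemma graph_hom_Bor_of_correspondence:
  assumes R: "correspondence X Y R"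
    and dis: "\<And>x y x' y'. (x, y) \<in> R \<Longrightarrow> (x', y') \<in> R \<Longrightarrow> \<bar>mdist X x x' - mdist Y y y'\<bar> \<le> \<delta>"
    and u: "\<delta> < u"
  shows "\<exists>f. graph_hom (Bor u X) (Bor (u - \<delta>) Y) f"
proof -
  have "\<forall>x \<in> mspace X. \<exists>y. (x, y) \<in> R"
    using R unfolding correspondence_def by force
  then obtain f where f: "\<And>x. x \<in> mspace X \<Longrightarrow> (x, f x) \<in> R"
    by metis
  have f_in: "f x \<in> mspace Y" if "x \<in> mspace X" for x
    using f[OF that] R unfolding correspondence_def by blast
  have far: "u - \<delta> \<le> mdist Y (f x) (f x')"
    if "x \<in> mspace X" "x' \<in> mspace X" "u \<le> mdist X x x'" for x x'
    using dis[OF f[OF that(1)] f[OF that(2)]] that(3) by linarith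
  \<comment> \<open>Adjacency also requires distinct images; this is where \<open>u > \<delta>\<close> enters.\<close>
  have distinct: "f x \<noteq> f x'" if "x \<in> mspace X" "x' \<in> mspace X" "u \<le> mdist X x x'" for x x'
    using far[OF that] u mdist_zero[OF f_in[OF that(1)] f_in[OF that(2)]] by auto
  have "graph_hom (Bor u X) (Bor (u - \<delta>) Y) f"
    unfolding graph_hom_def Bor_def by (simp add: image_subset_iff f_in far distinct del: diff_le_eq)
  then show ?thesis
    by blast
qed

lemma correspondence_converse:
  "correspondence X Y R \<Longrightarrow> correspondence Y X (R\<inverse>)"
  by (auto simp: correspondence_def fst_eq_Domain snd_eq_Range)

lemma dI_Bor_le_distortion:
  assumes R: "correspondence X Y R"
  shows "dI_Bor X Y \<le> distortion X Y R"
proof (cases "distortion X Y R")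
  case (real \<delta>)
  have dis: "\<bar>mdist X x x' - mdist Y y y'\<bar> \<le> \<delta>" if "(x, y) \<in> R" "(x', y') \<in> R" for x y x' y'
  proof -
    have "ennreal \<bar>mdist X x x' - mdist Y y y'\<bar> \<le> distortion X Y R"
      unfolding distortion_def using that
      by (intro SUP_upper2[of "((x, y), (x', y'))"]) auto
    with real show ?thesis
      by simp
  qed
  have "\<bar>mdist Y y y' - mdist X x x'\<bar> \<le> \<delta>" if "(y, x) \<in> R\<inverse>" "(y', x') \<in> R\<inverse>" for x y x' y'
    using dis[of x y x' y'] that by (simp add: abs_minus_commute)
  then have "(\<exists>f. graph_hom (Bor u X) (Bor (u - \<delta>) Y) f) \<and>
      (\<exists>g. graph_hom (Bor u Y) (Bor (u - \<delta>) X) g)" if "\<delta> < u" for u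
    using graph_hom_Bor_of_correspondence[OF R dis that]
      graph_hom_Bor_of_correspondence[OF correspondence_converse[OF R] _ that] by simp
  with real show ?thesis
    unfolding dI_Bor_def by (intro INF_lower2[of \<delta>]) auto
next
  case top
  then show ?thesis by simp
qed

lemma two_GH_dist: "2 * GH_dist X Y = (INF R \<in> {R. correspondence X Y R}. distortion X Y R)"
proof -
  have "2 * (1 / 2 :: ennreal) = 1"
    by (simp add: ennreal_times_divide)
  then show ?thesis
    unfolding GH_dist_def by (simp only: mult.assoc[symmetric] mult_1)
qed

theorem mainTheorem4:
  fixes X :: "'a metric" and Y :: "'b metric"
  assumes "mspace X \<noteq> {}" and "compact_space (mtopology_of X)"
    and "mspace Y \<noteq> {}" and "compact_space (mtopology_of Y)"
  shows "dI_chi X Y \<le> dI_Bor X Y \<and> dI_Bor X Y \<le> 2 * GH_dist X Y"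
  by (simp add: two_GH_dist dI_chi_le_dI_Bor le_INF_iff dI_Bor_le_distortion)

end
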